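(* Consider the generalized linear mixed model with response $Y$, real explanatory variable value $x$, random component $U$, response function $h$, variance function $V$, and parameter $\theta=(\beta,\sigma^2,\xi)$ as described in the context. Suppose that for all $k\in\mathbb{R}$ and each $\sigma>0$: i) the integral $\int_{\mathbb{R}}[h(k+\sigma z)]^2\,\phi(z)\,dz$ is finite; ii) the integral $\int_{\mathbb{R}}V[h(k+\sigma z)]\,\phi(z)\,dz$ is finite. Then $P_{\theta_1}\neq P_{\theta_2}$ for each pair of parameter values $\theta_1=(\beta,\sigma^2,\xi_1)$ and $\theta_2=(\beta,\sigma^2,\xi_2)$ such that $\xi_1\neq\xi_2$.
   Context: The model. The parameter is $\theta=(\beta,\sigma^2,\xi)$ with $\beta\in\mathbb{R}$, $\sigma>0$, and dispersion parameter $\xi>0$ (ranging over the values admissible for the exponential dispersion model below). The random component $U$ is a real, continuously distributed random variable with expectation $0$ and variance $\sigma^2$, belonging to a scale family: $U$ has density $u\mapsto\frac1\sigma\phi(u/\sigma)$, where $\phi$ is a fixed probability density on $\mathbb{R}$ with support $\mathbb{R}$, mean $0$ and variance $1$ (typically the standard normal density). For a given value $x\in\mathbb{R}$ of the explanatory variable, conditionally on $U=u$ the response $Y$ is distributed according to a member of a fixed exponential dispersion model, with $$E(Y\mid U=u)=h(x\beta+u),\qquad \mathrm{Var}(Y\mid U=u)=\xi\,V[h(x\beta+u)].$$ Here an exponential dispersion model is a family of distributions indexed by its mean $\mu$ and a dispersion parameter $\xi$, whose variance is $\xi V(\mu)$ with $V$ a (positive) variance function on the set of possible means; $h$ is the response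 function (the inverse of the link function), defined on $\mathbb{R}$ with values in the set of possible means, monotone (increasing or decreasing) and smooth. $P_\theta=P_{\beta,\sigma^2,\xi}$ denotes the (marginal) distribution of $Y$, for the given $x$, when the parameter is $\theta$. *)

theory Defs
  imports "HOL-Probability.Probability"
begin

text \<open>
  The support condition is that of the distribution (the set of points all of whose
  neighbourhoods have positive probability), so it does not depend on the version of the density.
\<close>

definition standardized_density :: "(real \<Rightarrow> real) \<Rightarrow> bool" where
  "standardized_density \<phi> \<longleftrightarrow>
     (let D = density lborel (\<lambda>z. ennreal (\<phi> z)) in
       \<phi> \<in> borel_measurable borel \<and> (\<forall>z. 0 \<le> \<phi> z) \<and> prob_space D \<and>
       (\<forall>A. open A \<longrightarrow> A \<noteq> {} \<longrightarrow> 0 < measure D A) \<and>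
       integrable D (\<lambda>z. z) \<and> prob_space.expectation D (\<lambda>z. z) = 0 \<and>
       integrable D (\<lambda>z. z\<^sup>2) \<and> prob_space.variance D (\<lambda>z. z) = 1)"

text \<open>
  A family \<open>Q \<mu> \<xi>\<close> of distributions on the real line, indexed by its mean \<open>\<mu>\<close> in the set \<open>M\<close> of
  possible means and by a dispersion parameter \<open>\<xi>\<close> in the set \<open>X\<close> of admissible values.  No
  particular form of the densities is imposed.  Measurability of \<open>\<mu> \<mapsto> Q \<mu> \<xi>\<close> is what makes the
  family usable as a conditional distribution.
\<close>

definition exponential_dispersion_model ::
    "real set \<Rightarrow> real set \<Rightarrow> (real \<Rightarrow> real) \<Rightarrow> (real \<Rightarrow> real \<Rightarrow> real measure) \<Rightarrow> bool" where
  "exponential_dispersion_model M X V Q \<longleftrightarrow>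
     X \<subseteq> {0<..} \<and> (\<forall>\<mu>\<in>M. 0 < V \<mu>) \<and>
     (\<forall>\<xi>\<in>X. (\<lambda>\<mu>. Q \<mu> \<xi>) \<in> restrict_space borel M \<rightarrow>\<^sub>M prob_algebra borel) \<and>
     (\<forall>\<mu>\<in>M. \<forall>\<xi>\<in>X.
        integrable (Q \<mu> \<xi>) (\<lambda>y. y) \<and> prob_space.expectation (Q \<mu> \<xi>) (\<lambda>y. y) = \<mu> \<and>
        integrable (Q \<mu> \<xi>) (\<lambda>y. y\<^sup>2) \<and> prob_space.variance (Q \<mu> \<xi>) (\<lambda>y. y) = \<xi> * V \<mu>)"

definition smooth :: "(real \<Rightarrow> real) \<Rightarrow> bool" where
  "smooth h \<longleftrightarrow> (\<forall>n t. (deriv ^^ n) h differentiable (at t))"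

definition response_function :: "real set \<Rightarrow> (real \<Rightarrow> real) \<Rightarrow> bool" where
  "response_function M h \<longleftrightarrow> range h \<subseteq> M \<and> (mono h \<or> antimono h) \<and> smooth h"

definition random_component :: "(real \<Rightarrow> real) \<Rightarrow> real \<Rightarrow> real measure" where
  "random_component \<phi> \<sigma> = density lborel (\<lambda>u. ennreal (1 / \<sigma> * \<phi> (u / \<sigma>)))"

text \<open>
  The marginal distribution of the response: draw \<open>u\<close> from the random component, then draw the
  response from the conditional distribution given \<open>u\<close>.  The second entry \<open>v\<close> of the parameter is
  the variance of the random component, whence the scale \<open>sqrt v\<close>.
\<close>

definition response_distribution ::
    "(real \<Rightarrow> real) \<Rightarrow> (real \<Rightarrow> real \<Rightarrow> real measure) \<Rightarrow> (real \<Rightarrow> real) \<Rightarrow> real \<Rightarrow>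
     real \<times> real \<times> real \<Rightarrow> real measure" where
  "response_distribution \<phi> Q h x = (\<lambda>(\<beta>, v, \<xi>).
     random_component \<phi> (sqrt v) \<bind> (\<lambda>u. Q (h (x * \<beta> + u)) \<xi>))"

end

theory Submission
  imports Defs
begin

text \<open>
  The two distributions have different second moments: by the law of total variance
  \<open>E(Y\<^sup>2) = \<xi> E(V(h(x\<beta> + U))) + E(h(x\<beta> + U)\<^sup>2)\<close>, both expectations on the right are finite and do
  not depend on \<open>\<xi>\<close>, and the first one is positive.
\<close>

lemma smooth_imp_borel_measurable:
  assumes "smooth h"
  shows "h \<in> borel_measurable borel"
proof (rule borel_measurable_continuous_onI)
  have "(deriv ^^ 0) h differentiable (at t)" for t
    using assms unfolding smooth_def by blast
  then show "continuous_on UNIV h"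
    by (simp add: differentiable_imp_continuous_within continuous_at_imp_continuous_on)
qed

text \<open>The substitution \<open>u = \<sigma> * z\<close> absorbs the factor
  \<open>1 / \<sigma>\<close> of the density. It brings integrals over the random component into the
  form in which the integrability conditions on \<open>h\<close> and \<open>V\<close> are stated.
  Working with \<open>ennreal\<close> values avoids any integrability condition on
  \<open>g\<close>.\<close>

lemma nn_integral_random_component:
  fixes \<phi> :: "real \<Rightarrow> real" and g :: "real \<Rightarrow> ennreal"
  assumes "0 < \<sigma>"
    and [measurable]: "\<phi> \<in> borel_measurable borel" "g \<in> borel_measurable borel"
    and "\<And>z. 0 \<le> \<phi> z"
  shows "(\<integral>\<^sup>+u. g u \<partial>random_component \<phi> \<sigma>) = (\<integral>\<^sup>+z. ennreal (\<phi> z) * g (\<sigma> * z) \<partial>lborel)"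
proof -
  have "(\<integral>\<^sup>+u. g u \<partial>random_component \<phi> \<sigma>)
      = (\<integral>\<^sup>+u. ennreal (1 / \<sigma> * \<phi> (u / \<sigma>)) * g u \<partial>lborel)"
    unfolding random_component_def by (rule nn_integral_density) auto
  \<comment> \<open>The summand \<open>0 +\<close> matches the affine map \<open>t + c * x\<close>
    of \<open>nn_integral_real_affine\<close>, taken with \<open>t = 0\<close> and
    \<open>c = \<sigma>\<close>.\<close>
  also have "\<dots> = ennreal \<bar>\<sigma>\<bar> *
      (\<integral>\<^sup>+z. ennreal (1 / \<sigma> * \<phi> ((0 + \<sigma> * z) / \<sigma>)) * g (0 + \<sigma> * z) \<partial>lborel)"
    using \<open>0 < \<sigma>\<close> by (intro nn_integral_real_affine) auto
  also have "\<dots> = (\<integral>\<^sup>+z. ennreal \<sigma> * (ennreal (1 / \<sigma> * \<phi> z) * g (\<sigma> * z)) \<partial>lborel)"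
    using \<open>0 < \<sigma>\<close> by (subst nn_integral_cmult[symmetric]) auto
  also have "\<dots> = (\<integral>\<^sup>+z. ennreal (\<phi> z) * g (\<sigma> * z) \<partial>lborel)"
    using assms(1,4) by (simp add: mult.assoc[symmetric] ennreal_mult[symmetric])
  finally show ?thesis .
qed

lemma (in prob_space) nn_integral_square_eq:
  fixes Y :: "'a \<Rightarrow> real"
  assumes "integrable M Y" and "integrable M (\<lambda>\<omega>. (Y \<omega>)\<^sup>2)"
  shows "(\<integral>\<^sup>+\<omega>. ennreal ((Y \<omega>)\<^sup>2) \<partial>M) = ennreal (variance Y + (expectation Y)\<^sup>2)"
  using assms by (simp add: nn_integral_eq_integral variance_eq)

text \<open>Conditioning on the random component gives \<open>Var + mean\<^sup>2\<close> of the
  conditional law, which is then averaged over \<open>\<phi>\<close>. With the moment as a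
  nonnegative integral, the iterated integration is valid before finiteness is known; finiteness
  comes out at the end from \<open>int_h\<close> and \<open>int_V\<close>.\<close>

lemma response_distribution_second_moment:
  assumes \<phi>: "standardized_density \<phi>"
    and Q: "exponential_dispersion_model M X V Q"
    and h: "response_function M h"
    and int_h: "integrable lborel (\<lambda>z. (h (x * \<beta> + \<sigma> * z))\<^sup>2 * \<phi> z)"
    and int_V: "integrable lborel (\<lambda>z. V (h (x * \<beta> + \<sigma> * z)) * \<phi> z)"
    and "0 < \<sigma>" and "\<xi> \<in> X"
  shows "(\<integral>\<^sup>+y. ennreal (y\<^sup>2) \<partial>response_distribution \<phi> Q h x (\<beta>, \<sigma>\<^sup>2, \<xi>))
       = ennreal (\<xi> * (\<integral>z. V (h (x * \<beta> + \<sigma> * z)) * \<phi> z \<partial>lborel)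
                  + (\<integral>z. (h (x * \<beta> + \<sigma> * z))\<^sup>2 * \<phi> z \<partial>lborel))"
proof -
  have \<phi>_meas [measurable]: "\<phi> \<in> borel_measurable borel" and \<phi>_nonneg: "\<And>z. 0 \<le> \<phi> z"
    using \<phi> by (simp_all add: standardized_density_def Let_def)
  have h_meas [measurable]: "h \<in> borel_measurable borel" and h_in: "\<And>t. h t \<in> M"
    using h by (auto simp: response_function_def intro: smooth_imp_borel_measurable)
  have V_pos: "\<And>\<mu>. \<mu> \<in> M \<Longrightarrow> 0 < V \<mu>" and "0 < \<xi>"
    using Q \<open>\<xi> \<in> X\<close> by (auto simp: exponential_dispersion_model_def)
  have Q_meas: "(\<lambda>\<mu>. Q \<mu> \<xi>) \<in> restrict_space borel M \<rightarrow>\<^sub>M prob_algebra borel"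
    using Q \<open>\<xi> \<in> X\<close> by (simp add: exponential_dispersion_model_def)
  define K where "K = (\<lambda>u. Q (h (x * \<beta> + u)) \<xi>)"
  \<comment> \<open>\<open>Q\<close> is measurable in the mean only on the set \<open>M\<close> of
    possible means, so the inner map must be seen as a map into that restricted space.\<close>
  have "(\<lambda>u. h (x * \<beta> + u)) \<in> borel \<rightarrow>\<^sub>M restrict_space borel M"
    using h_in by (intro measurable_restrict_space2) auto
  then have K_prob: "K \<in> borel \<rightarrow>\<^sub>M prob_algebra borel"
    unfolding K_def using Q_meas by (rule measurable_compose)
  then have K_meas: "K \<in> borel \<rightarrow>\<^sub>M subprob_algebra borel"
    by (rule measurable_prob_algebraD)
  have K_moment: "(\<integral>\<^sup>+y. ennreal (y\<^sup>2) \<partial>K u)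
      = ennreal (\<xi> * V (h (x * \<beta> + u)) + (h (x * \<beta> + u))\<^sup>2)" for u
  proof -
    have "prob_space (K u)"
      using measurable_space[OF K_prob, of u] by (simp add: space_prob_algebra)
    then interpret prob_space "K u" .
    have "integrable (K u) (\<lambda>y. y)" "integrable (K u) (\<lambda>y. y\<^sup>2)"
      and "expectation (\<lambda>y. y) = h (x * \<beta> + u)"
      and "variance (\<lambda>y. y) = \<xi> * V (h (x * \<beta> + u))"
      using Q \<open>\<xi> \<in> X\<close> h_in[of "x * \<beta> + u"]
      unfolding exponential_dispersion_model_def K_def by blast+
    then show ?thesis
      using nn_integral_square_eq[of "\<lambda>y. y"] by metis
  qed
  \<comment> \<open>The parameter holds the variance, and
    \<open>sqrt (\<sigma>\<^sup>2) = \<sigma>\<close> because \<open>\<sigma>\<close> is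
    positive.\<close>
  have "(\<integral>\<^sup>+y. ennreal (y\<^sup>2) \<partial>response_distribution \<phi> Q h x (\<beta>, \<sigma>\<^sup>2, \<xi>))
      = (\<integral>\<^sup>+y. ennreal (y\<^sup>2) \<partial>(random_component \<phi> \<sigma> \<bind> K))"
    using \<open>0 < \<sigma>\<close> by (simp add: response_distribution_def K_def)
  also have "\<dots> = (\<integral>\<^sup>+u. \<integral>\<^sup>+y. ennreal (y\<^sup>2) \<partial>K u \<partial>random_component \<phi> \<sigma>)"
    using K_meas by (intro nn_integral_bind[where B = borel]) (auto simp: random_component_def)
  also have "\<dots> = (\<integral>\<^sup>+z. ennreal (\<phi> z) * (\<integral>\<^sup>+y. ennreal (y\<^sup>2) \<partial>K (\<sigma> * z)) \<partial>lborel)"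
    using \<open>0 < \<sigma>\<close> \<phi>_meas \<phi>_nonneg
    by (intro nn_integral_random_component
        measurable_compose[OF K_meas nn_integral_measurable_subprob_algebra]) auto
  also have "\<dots> = (\<integral>\<^sup>+z. ennreal (\<xi> * (V (h (x * \<beta> + \<sigma> * z)) * \<phi> z)
      + (h (x * \<beta> + \<sigma> * z))\<^sup>2 * \<phi> z) \<partial>lborel)"
    unfolding K_moment using \<phi>_nonneg by (simp add: ennreal_mult'[symmetric] algebra_simps)
  \<comment> \<open>The integrand is integrable and nonnegative (\<open>V\<close> is positive on
    \<open>M\<close>, \<open>\<xi>\<close> is positive), so its nonnegative integral is the Bochner
    integral, which then splits by linearity.\<close>
  also have "\<dots> = ennreal (\<integral>z. \<xi> * (V (h (x * \<beta> + \<sigma> * z)) * \<phi> z)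
      + (h (x * \<beta> + \<sigma> * z))\<^sup>2 * \<phi> z \<partial>lborel)"
    using int_h int_V \<phi>_nonneg V_pos[OF h_in, THEN less_imp_le] \<open>0 < \<xi>\<close>
    by (intro nn_integral_eq_integral AE_I2 add_nonneg_nonneg mult_nonneg_nonneg) auto
  finally show ?thesis
    using int_h int_V by simp
qed

text \<open>If the integral vanished, so would \<open>f z * \<phi> z\<close> almost everywhere,
  hence \<open>\<phi>\<close> itself since \<open>f\<close> has no zeros; this contradicts total
  mass 1. It is applied to \<open>V\<close> composed with \<open>h\<close>, giving a positive
  coefficient of the dispersion parameter.\<close>

lemma standardized_density_weighted_integral_pos:
  fixes f :: "real \<Rightarrow> real"
  assumes \<phi>: "standardized_density \<phi>" and f_pos: "\<And>z. 0 < f z"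
    and int: "integrable lborel (\<lambda>z. f z * \<phi> z)"
  shows "0 < (\<integral>z. f z * \<phi> z \<partial>lborel)"
proof -
  have [measurable]: "\<phi> \<in> borel_measurable borel" and \<phi>_nonneg: "\<And>z. 0 \<le> \<phi> z"
    and "prob_space (density lborel (\<lambda>z. ennreal (\<phi> z)))"
    using \<phi> by (simp_all add: standardized_density_def Let_def)
  then have total: "(\<integral>\<^sup>+z. ennreal (\<phi> z) \<partial>lborel) = 1"
    using prob_space.emeasure_space_1 by (fastforce simp: emeasure_density)
  have nonneg: "0 \<le> f z * \<phi> z" for z
    using f_pos[of z] \<phi>_nonneg[of z] by simp
  have "(\<integral>z. f z * \<phi> z \<partial>lborel) \<noteq> 0"
  proof
    assume "(\<integral>z. f z * \<phi> z \<partial>lborel) = 0"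
    then have "AE z in lborel. f z * \<phi> z = 0"
      using integral_nonneg_eq_0_iff_AE[OF int] nonneg by simp
    then have "AE z in lborel. ennreal (\<phi> z) = 0"
      by eventually_elim (use f_pos in \<open>auto simp: less_le\<close>)
    then have "(\<integral>\<^sup>+z. ennreal (\<phi> z) \<partial>lborel) = 0"
      by (subst nn_integral_0_iff_AE) auto
    with total show False by simp
  qed
  moreover have "0 \<le> (\<integral>z. f z * \<phi> z \<partial>lborel)"
    using nonneg by simp
  ultimately show ?thesis by simp
qed

theorem proposition2:
  fixes \<phi> h V :: "real \<Rightarrow> real"
    and M X :: "real set"
    and Q :: "real \<Rightarrow> real \<Rightarrow> real measure"
    and x \<beta> \<sigma> \<xi>\<^sub>1 \<xi>\<^sub>2 :: real
  assumes "standardized_density \<phi>"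
    and "exponential_dispersion_model M X V Q"
    and "response_function M h"
    and "\<And>k s. 0 < s \<Longrightarrow> integrable lborel (\<lambda>z. (h (k + s * z))\<^sup>2 * \<phi> z)"
    and "\<And>k s. 0 < s \<Longrightarrow> integrable lborel (\<lambda>z. V (h (k + s * z)) * \<phi> z)"
    and "0 < \<sigma>" and "\<xi>\<^sub>1 \<in> X" and "\<xi>\<^sub>2 \<in> X" and "\<xi>\<^sub>1 \<noteq> \<xi>\<^sub>2"
  shows "response_distribution \<phi> Q h x (\<beta>, \<sigma>\<^sup>2, \<xi>\<^sub>1) \<noteq> response_distribution \<phi> Q h x (\<beta>, \<sigma>\<^sup>2, \<xi>\<^sub>2)"
proof
  let ?A = "\<integral>z. V (h (x * \<beta> + \<sigma> * z)) * \<phi> z \<partial>lborel"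
  let ?B = "\<integral>z. (h (x * \<beta> + \<sigma> * z))\<^sup>2 * \<phi> z \<partial>lborel"
  assume eq: "response_distribution \<phi> Q h x (\<beta>, \<sigma>\<^sup>2, \<xi>\<^sub>1) = response_distribution \<phi> Q h x (\<beta>, \<sigma>\<^sup>2, \<xi>\<^sub>2)"
  have pos: "0 < \<xi>\<^sub>1" "0 < \<xi>\<^sub>2" and V_pos: "0 < V (h t)" for t
    using assms(2,3,7,8) by (auto simp: exponential_dispersion_model_def response_function_def)
  have A: "0 < ?A"
    using standardized_density_weighted_integral_pos[OF assms(1) V_pos assms(5)[OF assms(6)]] .
  have B: "0 \<le> ?B"
    using assms(1) by (intro Bochner_Integration.integral_nonneg) (simp add: standardized_density_def Let_def)
  \<comment> \<open>The only premise left open is membership of the dispersion parameter in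
    \<open>X\<close>, so one fact serves both parameter values.\<close>
  note moment = response_distribution_second_moment
    [OF assms(1-3) assms(4)[OF assms(6)] assms(5)[OF assms(6)] assms(6)]
  have "ennreal (\<xi>\<^sub>1 * ?A + ?B) = ennreal (\<xi>\<^sub>2 * ?A + ?B)"
    using moment[OF assms(7)] moment[OF assms(8)] eq by metis
  \<comment> \<open>\<open>ennreal\<close> sends all negative reals to 0, so it can be cancelled
    only after both sides are known to be nonnegative.\<close>
  then have "\<xi>\<^sub>1 * ?A + ?B = \<xi>\<^sub>2 * ?A + ?B"
    using A B pos by (subst (asm) ennreal_inj) auto
  with A assms(9) show False by simp
qed

end
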